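(* For positive integers $p,q$ let $h(p,q)$ be the number of Hamiltonian paths in $DGG_{p,q}$. Then for every positive integer $n$, $$h(3,n)=h(n,3)=F_n,$$ where $F_1=1$, $F_2=1$ and $F_n=F_{n-1}+F_{n-2}$ for $n\ge 3$ are the Fibonacci numbers.
   Context: For positive integers $p,q$, $DGG_{p,q}$ is the directed graph with vertex set $\{1,\dots,p\}\times\{1,\dots,q\}$ having as arcs, whenever both endpoints are vertices: $(x;y)\to(x+1;y)$ if $y$ is odd; $(x;y)\to(x-1;y)$ if $y$ is even; $(x;y)\to(x;y+1)$ if $x$ is odd; $(x;y)\to(x;y-1)$ if $x$ is even. A Hamiltonian path of $DGG_{p,q}$ is an ordering $v_1\to v_2\to\dots\to v_{pq}$ of all the vertices such that $v_n\to v_{n+1}$ is an arc for each $n\in\{1,\dots,pq-1\}$; $h(p,q)$ denotes the number of such orderings. *)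

theory Defs
  imports "Graph_Theory.Graph_Theory" "HOL-Number_Theory.Fib"
begin

text \<open>Decreasing steps are written \<open>x = x' + 1\<close> to avoid truncated subtraction on \<open>nat\<close>.\<close>

definition dgg_step :: "nat \<times> nat \<Rightarrow> nat \<times> nat \<Rightarrow> bool" where
  "dgg_step u v \<longleftrightarrow> (case (u, v) of ((x, y), (x', y')) \<Rightarrow>
       (odd y \<and> x' = x + 1 \<and> y' = y) \<or>
       (even y \<and> x = x' + 1 \<and> y' = y) \<or>
       (odd x \<and> x' = x \<and> y' = y + 1) \<or>
       (even x \<and> x' = x \<and> y = y' + 1))"

definition DGG :: "nat \<Rightarrow> nat \<Rightarrow> (nat \<times> nat) pair_pre_digraph" where
  "DGG p q =
     \<lparr> pverts = {1..p} \<times> {1..q},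
       parcs = {(u, v). u \<in> {1..p} \<times> {1..q} \<and> v \<in> {1..p} \<times> {1..q} \<and> dgg_step u v} \<rparr>"

text \<open>A \<^const>\<open>vpath\<close> is a nonempty list of pairwise distinct vertices whose consecutive
  entries are joined by arcs.\<close>

definition hamiltonian_path :: "'a vwalk \<Rightarrow> ('a, 'b) pre_digraph \<Rightarrow> bool" where
  "hamiltonian_path vs G \<longleftrightarrow> vpath vs G \<and> set vs = verts G"

definition h :: "nat \<Rightarrow> nat \<Rightarrow> nat" where
  "h p q = card {vs. hamiltonian_path vs (with_proj (DGG p q))}"

lemma finite_hamiltonian_paths: "finite {vs. hamiltonian_path vs (with_proj (DGG p q))}"
proof (rule finite_subset)
  let ?V = "{1..p} \<times> {1..q}"
  show "{vs. hamiltonian_path vs (with_proj (DGG p q))} \<subseteq> {vs. set vs \<subseteq> ?V \<and> length vs \<le> card ?V}"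
    by (auto simp: hamiltonian_path_def vpath_def DGG_def simp flip: distinct_card)
  show "finite {vs. set vs \<subseteq> ?V \<and> length vs \<le> card ?V}"
    by (rule finite_lists_length_le) simp
qed

end

theory Submission
  imports Defs "HOL-Library.Sublist"
begin

text \<open>
  Consider a Hamiltonian path of the rows \<open>m, m + 1, \<dots>\<close> of the strip of width three, where row \<open>m\<close>
  runs \<open>p \<rightarrow> 2 \<rightarrow> q\<close> with \<open>{p, q} = {1, 3}\<close>. The corner \<open>(p; m)\<close> has no predecessor, so it is
  the first vertex. If the path first moves to \<open>(2; m)\<close>, it finishes row \<open>m\<close>, and what remains is
  a Hamiltonian path of the rows from \<open>m + 1\<close> on. If it first moves up, comparing possible
  predecessors forces it to run through \<open>(2; m + 2), (2; m + 1), (2; m), (q; m), (q; m + 1), (q; m + 2)\<close>.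
  Contracting this segment to the arc \<open>(2; m + 2) \<rightarrow> (q; m + 2)\<close>, which every Hamiltonian path of the
  rows from \<open>m + 2\<close> on uses, gives a bijection with those paths. Hence the Fibonacci recursion.
  Reflection in the diagonal exchanges \<open>DGG\<^bsub>p,q\<^esub>\<close> and \<open>DGG\<^bsub>q,p\<^esub>\<close>.
\<close>

section \<open>Consecutive entries in lists without repetition\<close>

lemma sublist_chain:
  assumes "sublist (ss @ [v]) vs" "sublist [v, w] vs" "distinct vs"
  shows "sublist (ss @ [v, w]) vs"
proof -
  obtain xs ys where 1: "vs = xs @ (ss @ [v]) @ ys"
    using assms(1) unfolding sublist_def by blast
  obtain xs' ys' where 2: "vs = xs' @ [v, w] @ ys'"
    using assms(2) unfolding sublist_def by blast
  have "(xs @ ss) @ v # ys = xs' @ v # (w # ys')"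
    using 1 2 by simp
  moreover have "v \<notin> set (xs @ ss)" "v \<notin> set ys"
    using 1 assms(3) by auto
  \<comment> \<open>As \<open>v\<close> occurs only once in \<open>vs\<close>, both decompositions
    split at the same place.\<close>
  ultimately have "ys = w # ys'"
    using append_Cons_eq_iff[of v "xs @ ss" ys xs' "w # ys'"] by simp
  then have "vs = xs @ (ss @ [v, w]) @ ys'"
    using 1 by simp
  then show ?thesis
    unfolding sublist_def by blast
qed

lemma sublist_succ_unique:
  assumes "sublist [v, u] vs" "sublist [v, w] vs" "distinct vs"
  shows "u = w"
proof -
  obtain xs ys where 1: "vs = xs @ [v, u] @ ys"
    using assms(1) unfolding sublist_def by blast
  obtain xs' ys' where 2: "vs = xs' @ [v, w] @ ys'"
    using assms(2) unfolding sublist_def by blast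
  have "xs @ v # (u # ys) = xs' @ v # (w # ys')"
    using 1 2 by simp
  moreover have "v \<notin> set xs" "v \<notin> set (u # ys)"
    using 1 assms(3) by auto
  ultimately show ?thesis
    using append_Cons_eq_iff[of v xs "u # ys" xs' "w # ys'"] by simp
qed

section \<open>Hamiltonian paths as lists over an arbitrary vertex set\<close>

definition ham_lists :: "(nat \<times> nat) set \<Rightarrow> (nat \<times> nat) list set" where
  "ham_lists V = {vs. vs \<noteq> [] \<and> distinct vs \<and> set vs = V \<and> successively dgg_step vs}"

lemma ham_lists_nonempty: "vs \<in> ham_lists V \<Longrightarrow> V \<noteq> {}"
  by (auto simp: ham_lists_def)

lemma finite_ham_lists: "finite V \<Longrightarrow> finite (ham_lists V)"
  by (rule finite_subset[OF _ finite_subset_distinct[of V]]) (auto simp: ham_lists_def)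

lemma ham_lists_pred:
  assumes "vs \<in> ham_lists V" "v \<in> V" "hd vs \<noteq> v"
  obtains u where "u \<in> V" "dgg_step u v" "sublist [u, v] vs"
proof -
  have v: "v \<in> set vs" and ne: "vs \<noteq> []" and V: "V = set vs"
    and succ: "successively dgg_step vs"
    using assms by (auto simp: ham_lists_def)
  obtain xs ys where vs: "vs = xs @ v # ys"
    using v by (meson split_list)
  with assms(3) have "xs \<noteq> []"
    by auto
  then obtain xs' u where "xs = xs' @ [u]"
    by (meson rev_exhaust)
  with vs have "vs = xs' @ [u, v] @ ys"
    by simp
  with succ V show ?thesis
    by (intro that[of u]) (auto simp: successively_append_iff sublist_def)
qed

text \<open>The source of all forced arcs below: every vertex but the first is entered from
  somewhere, so a single candidate for its predecessor must be used.\<close>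

lemma ham_lists_unique_pred:
  assumes "vs \<in> ham_lists V" "v \<in> V" "hd vs \<noteq> v"
    and "\<And>u. u \<in> V \<Longrightarrow> dgg_step u v \<Longrightarrow> u = w"
  shows "sublist [w, v] vs"
  using ham_lists_pred[OF assms(1-3)] assms(4) by metis

lemma vwalk_arcs_successively:
  "set (vwalk_arcs vs) \<subseteq> {(u, v). P u v} \<longleftrightarrow> successively P vs"
  by (induction vs rule: vwalk_arcs.induct) auto

lemma set_vwalk_arcs_subset: "set (vwalk_arcs vs) \<subseteq> set vs \<times> set vs"
  by (induction vs rule: vwalk_arcs.induct) auto

text \<open>The entries of the list are exactly the grid points, so both ends of each arc lie in the
  grid automatically and only \<open>dgg_step\<close> remains to be checked.\<close>

lemma hamiltonian_path_DGG:
  "{vs. hamiltonian_path vs (with_proj (DGG p q))} = ham_lists ({1..p} \<times> {1..q})"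
proof -
  have "hamiltonian_path vs (with_proj (DGG p q)) \<longleftrightarrow> vs \<in> ham_lists ({1..p} \<times> {1..q})" for vs
    unfolding hamiltonian_path_def vpath_def vwalk_def ham_lists_def DGG_def
    using set_vwalk_arcs_subset[of vs] vwalk_arcs_successively[of vs dgg_step]
    by auto
  then show ?thesis
    by blast
qed

section \<open>Reflection in the diagonal\<close>

lemma dgg_step_swap: "dgg_step (prod.swap u) (prod.swap v) \<longleftrightarrow> dgg_step u v"
  by (auto simp: dgg_step_def split: prod.splits)

lemma map_swap_ham_lists:
  assumes "vs \<in> ham_lists (A \<times> B)"
  shows "map prod.swap vs \<in> ham_lists (B \<times> A)"
  using assms
  by (auto simp: ham_lists_def distinct_map successively_map dgg_step_swap product_swap)

lemma h_commute: "h p q = h q p"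
  unfolding h_def hamiltonian_path_DGG
  by (rule bij_betw_same_card[of "map prod.swap"],
      rule bij_betw_byWitness[where f' = "map prod.swap"])
     (auto intro: map_swap_ham_lists simp: o_def)

section \<open>Forced arcs in the lowest row of a strip of width three\<close>

definition strip :: "nat \<Rightarrow> nat \<Rightarrow> (nat \<times> nat) set" where
  "strip m k = {1, 2, 3} \<times> {m..<m + k}"

text \<open>Row \<open>m\<close> is directed from column \<open>entry m\<close> through column 2 to column \<open>entry (Suc m)\<close>.\<close>

definition entry :: "nat \<Rightarrow> nat" where
  "entry m = (if odd m then 1 else 3)"

lemma entry_Suc_Suc [simp]: "entry (Suc (Suc m)) = entry m"
  by (simp add: entry_def)

lemma entry_neq [simp]: "entry m \<noteq> 2" "2 \<noteq> entry m"
    "entry m \<noteq> Suc (Suc 0)" "Suc (Suc 0) \<noteq> entry m"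
    "entry m \<noteq> entry (Suc m)" "entry (Suc m) \<noteq> entry m"
  by (auto simp: entry_def)

lemma columns: "{1, 2, 3} = {entry m, 2, entry (Suc m)}"
  by (auto simp: entry_def)

lemma strip_Suc:
  "strip m (Suc k) = {(entry m, m), (2, m), (entry (Suc m), m)} \<union> strip (Suc m) k"
  unfolding strip_def columns[of m] by auto

lemma strip_0 [simp]: "strip m 0 = {}"
  by (simp add: strip_def)

lemma below_strip [simp]: "y < m \<Longrightarrow> (x, y) \<notin> strip m k"
  by (simp add: strip_def)

lemma step_from_row:
  "dgg_step (entry m, m) (2, m)" "dgg_step (2, m) (entry (Suc m), m)"
  "dgg_step (entry m, m) (entry m, Suc m)"
  "dgg_step (entry (Suc m), m) (entry (Suc m), Suc m)"
  "dgg_step (2, Suc m) (2, m)"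
  by (auto simp: dgg_step_def entry_def)

text \<open>Row \<open>m\<close> leads away from this corner, and its column is odd and runs
  upwards, so an arc into the corner could only come from row \<open>m - 1\<close>, outside the
  strip.\<close>

lemma ham_lists_hd:
  assumes "vs \<in> ham_lists (strip m (Suc k))"
  shows "hd vs = (entry m, m)"
proof (rule ccontr)
  assume "hd vs \<noteq> (entry m, m)"
  moreover have "(entry m, m) \<in> strip m (Suc k)"
    by (simp add: strip_Suc)
  ultimately obtain u where "u \<in> strip m (Suc k)" "dgg_step u (entry m, m)"
    using ham_lists_pred[OF assms] by metis
  then show False
    by (cases u) (auto simp: strip_def dgg_step_def entry_def split: if_splits)
qed

text \<open>The other outer column runs upwards too, so the far corner of row \<open>m\<close> can
  be entered only along the row.\<close>

lemma ham_lists_row_arc: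
  assumes "vs \<in> ham_lists (strip m (Suc k))"
  shows "sublist [(2, m), (entry (Suc m), m)] vs"
proof (rule ham_lists_unique_pred[OF assms])
  show "(entry (Suc m), m) \<in> strip m (Suc k)"
    by (simp add: strip_Suc)
  show "hd vs \<noteq> (entry (Suc m), m)"
    using ham_lists_hd[OF assms] by simp
  show "u = (2, m)" if "u \<in> strip m (Suc k)" "dgg_step u (entry (Suc m), m)" for u
    using that by (cases u) (auto simp: strip_def dgg_step_def entry_def split: if_splits)
qed

section \<open>Extending a path by one row or by two rows\<close>

definition add_row :: "nat \<Rightarrow> (nat \<times> nat) list \<Rightarrow> (nat \<times> nat) list" where
  "add_row m ws = [(entry m, m), (2, m), (entry (Suc m), m)] @ ws"

text \<open>Undoes the contraction vertex by vertex, so that no splitting of the list at the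
  contracted arc is needed. The detour ends just below \<open>(entry (Suc m), m + 2)\<close>, the
  vertex that follows \<open>(2, m + 2)\<close> on every path concerned.\<close>

definition detour :: "nat \<Rightarrow> nat \<times> nat \<Rightarrow> (nat \<times> nat) list" where
  "detour m v = (if v = (2, m + 2)
     then [(2, m + 2), (2, m + 1), (2, m), (entry (Suc m), m), (entry (Suc m), m + 1)]
     else [v])"

definition add_two_rows :: "nat \<Rightarrow> (nat \<times> nat) list \<Rightarrow> (nat \<times> nat) list" where
  "add_two_rows m ws = [(entry m, m), (entry m, m + 1)] @ concat (map (detour m) ws)"

lemma concat_map_detour: "(2, m + 2) \<notin> set ws \<Longrightarrow> concat (map (detour m) ws) = ws"
  by (induction ws) (auto simp: detour_def)

lemma add_two_rows_split:
  assumes "distinct (xs @ [(2, m + 2)] @ ys)"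
  shows "add_two_rows m (xs @ [(2, m + 2)] @ ys) = [(entry m, m), (entry m, m + 1)] @ xs @
    [(2, m + 2), (2, m + 1), (2, m), (entry (Suc m), m), (entry (Suc m), m + 1)] @ ys"
proof -
  have "concat (map (detour m) xs) = xs" "concat (map (detour m) ys) = ys"
    using assms by (intro concat_map_detour; auto)+
  then show ?thesis
    by (simp add: add_two_rows_def detour_def)
qed

lemma inj_add_row: "inj (add_row m)"
  by (simp add: inj_def add_row_def)

text \<open>All inserted vertices lie in rows \<open>m\<close> and \<open>m + 1\<close>, so
  filtering by height is a left inverse; this gives injectivity of
  \<open>add_two_rows\<close>.\<close>

lemma filter_concat_map_detour:
  assumes "\<forall>v\<in>set ws. m + 2 \<le> snd v"
  shows "filter (\<lambda>v. m + 2 \<le> snd v) (concat (map (detour m) ws)) = ws"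
  using assms by (induction ws) (auto simp: detour_def)

lemma inj_on_add_two_rows: "inj_on (add_two_rows m) (ham_lists (strip (m + 2) k))"
proof (rule inj_on_inverseI)
  fix ws assume "ws \<in> ham_lists (strip (m + 2) k)"
  then have "\<forall>v\<in>set ws. m + 2 \<le> snd v"
    by (auto simp: ham_lists_def strip_def)
  then show "filter (\<lambda>v. m + 2 \<le> snd v) (add_two_rows m ws) = ws"
    using filter_concat_map_detour[of ws m] by (simp add: add_two_rows_def)
qed

text \<open>The pieces fit because \<open>ws\<close> starts at the entry corner of row
  \<open>Suc m\<close>, directly above the end of row \<open>m\<close>.\<close>

lemma add_row_in_ham_lists:
  assumes ws: "ws \<in> ham_lists (strip (Suc m) (Suc k))"
  shows "add_row m ws \<in> ham_lists (strip m (Suc (Suc k)))"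
proof -
  have *: "ws \<noteq> []" "distinct ws" "set ws = strip (Suc m) (Suc k)" "successively dgg_step ws"
    using ws by (auto simp: ham_lists_def)
  have "set (add_row m ws) = strip m (Suc (Suc k))"
    by (auto simp: add_row_def strip_Suc[of m] *)
  moreover have "distinct (add_row m ws)"
    using *(2,3) by (auto simp: add_row_def)
  moreover have "successively dgg_step (add_row m ws)"
    using * ham_lists_hd[OF ws]
    by (auto simp: add_row_def successively_Cons step_from_row)
  ultimately show ?thesis
    by (simp add: ham_lists_def add_row_def)
qed

lemma ham_lists_strip_split:
  assumes ws: "ws \<in> ham_lists (strip m (Suc k))"
  obtains xs ys where "ws = (entry m, m) # xs @ [(2, m), (entry (Suc m), m)] @ ys"
proof -
  obtain xs ys where 1: "ws = xs @ [(2, m), (entry (Suc m), m)] @ ys"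
    using ham_lists_row_arc[OF ws] unfolding sublist_def by blast
  with ham_lists_hd[OF ws] obtain xs' where "xs = (entry m, m) # xs'"
    by (cases xs) auto
  with 1 that show ?thesis
    by simp
qed

lemma add_two_rows_in_ham_lists:
  assumes ws: "ws \<in> ham_lists (strip (m + 2) k)"
  shows "add_two_rows m ws \<in> ham_lists (strip m (Suc (Suc k)))"
proof -
  have "k \<noteq> 0"
    using ham_lists_nonempty[OF ws] by (intro notI) simp
  then obtain k' where k: "k = Suc k'"
    by (cases k) auto
  have *: "distinct ws" "set ws = strip (m + 2) k" "successively dgg_step ws"
    using ws by (auto simp: ham_lists_def)
  \<comment> \<open>Rows \<open>m\<close> and \<open>m + 2\<close> have the same direction, so the
    first vertex and the forced row arc of \<open>ws\<close> are in the columns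
    \<open>entry m\<close> and \<open>entry (Suc m)\<close>.\<close>
  obtain xs ys where split:
    "ws = ((entry m, m + 2) # xs) @ [(2, m + 2)] @ [(entry (Suc m), m + 2)] @ ys"
    using ham_lists_strip_split[OF ws[unfolded k]] by auto
  have eq: "add_two_rows m ws = [(entry m, m), (entry m, m + 1)] @ ((entry m, m + 2) # xs) @
    [(2, m + 2), (2, m + 1), (2, m), (entry (Suc m), m), (entry (Suc m), m + 1)] @
    [(entry (Suc m), m + 2)] @ ys"
    using add_two_rows_split *(1) unfolding split by blast
  have rows: "v \<in> set ws \<Longrightarrow> m + 2 \<le> snd v" for v
    using below_strip[of "snd v" "m + 2" "fst v" k] *(2) not_less by auto
  have "set (add_two_rows m ws) = set ws \<union> {(entry m, m), (entry m, m + 1), (2, m + 1), (2, m),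
     (entry (Suc m), m), (entry (Suc m), m + 1)}"
    unfolding eq by (auto simp: split)
  also have "\<dots> = strip m (Suc (Suc k))"
    unfolding *(2) strip_Suc[of m] strip_Suc[of "Suc m"] by auto
  finally have "set (add_two_rows m ws) = strip m (Suc (Suc k))" .
  moreover have "distinct (add_two_rows m ws)"
  proof -
    have "(x, y) \<notin> set xs" "(x, y) \<notin> set ys" if "y < m + 2" for x y
      using rows[of "(x, y)"] that unfolding split by auto
    then show ?thesis
      using *(1)[unfolded split] unfolding eq by auto
  qed
  moreover have "successively dgg_step (add_two_rows m ws)"
    using *(3)[unfolded split] step_from_row[of m] step_from_row[of "Suc m"] unfolding eq
    by (auto simp: successively_append_iff successively_Cons hd_append)
  ultimately show ?thesis
    by (simp add: ham_lists_def add_two_rows_def)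
qed

section \<open>Decomposing a path by its first move\<close>

lemma ham_lists_cases:
  assumes vs: "vs \<in> ham_lists (strip m (Suc (Suc k)))"
  shows "vs \<in> add_row m ` ham_lists (strip (Suc m) (Suc k))
       \<union> add_two_rows m ` ham_lists (strip (m + 2) k)"
proof -
  let ?p = "entry m" and ?q = "entry (Suc m)" and ?S = "strip m (Suc (Suc k))"
  have *: "vs \<noteq> []" "distinct vs" "set vs = ?S" "successively dgg_step vs"
    using vs by (auto simp: ham_lists_def)
  obtain ws where ws: "vs = (?p, m) # ws"
    using ham_lists_hd[OF vs] *(1) by (cases vs) auto
  have in_S: "(?p, m) \<in> ?S" "(2, m) \<in> ?S" "(?q, m) \<in> ?S"
      "(?p, m + 1) \<in> ?S" "(2, m + 1) \<in> ?S" "(?q, m + 1) \<in> ?S"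
    by (simp_all add: strip_Suc)
  have "(2, m) \<in> set vs"
    using in_S *(3) by simp
  then have "ws \<noteq> []"
    using ws by auto
  then obtain v ws' where ws': "ws = v # ws'"
    by (cases ws) auto
  have "dgg_step (?p, m) v" "v \<in> ?S"
    using *(3,4) ws ws' by (auto simp: successively_Cons)
  then consider (row) "v = (2, m)" | (up) "v = (?p, m + 1)"
    by (cases v) (auto simp: strip_def dgg_step_def entry_def split: if_splits)
  then show ?thesis
  proof cases
    case row
    obtain xs ys where split: "vs = (?p, m) # xs @ [(2, m), (?q, m)] @ ys"
      using ham_lists_strip_split[OF vs] by blast
    \<comment> \<open>The vertex \<open>(2, m)\<close> is already the second entry and cannot
      recur.\<close>
    have "xs = []"
      using split ws ws' row *(2) by (cases xs) auto
    with split have vs_eq: "vs = add_row m ys"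
      by (simp add: add_row_def)
    have "set ys = strip (Suc m) (Suc k)"
    proof -
      have "set ys = set vs - {(?p, m), (2, m), (?q, m)}"
        using *(2) unfolding vs_eq add_row_def by auto
      then show ?thesis
        unfolding *(3) strip_Suc[of m "Suc k"] by auto
    qed
    moreover from this have "ys \<noteq> []"
      by (auto simp: strip_Suc)
    ultimately have "ys \<in> ham_lists (strip (Suc m) (Suc k))"
      using * unfolding vs_eq by (auto simp: ham_lists_def add_row_def successively_Cons)
    with vs_eq show ?thesis
      by blast
  next
    case up
    have hd: "hd vs = (?p, m)" and vs_up: "vs = (?p, m) # (?p, m + 1) # ws'"
      using ws ws' up by simp_all
    have "ws' \<noteq> []"
      using \<open>(2, m) \<in> set vs\<close> unfolding vs_up by auto
    then obtain v' ws'' where "ws' = v' # ws''"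
      by (cases ws') auto
    then have "dgg_step (?p, m + 1) v'" "v' \<in> ?S"
      using *(3,4) vs_up by (auto simp: successively_Cons)
    \<comment> \<open>Row \<open>m + 1\<close> ends at \<open>(?p, m + 1)\<close>, so the only way
      on is up to row \<open>m + 2\<close>, which must therefore exist.\<close>
    then have "k \<noteq> 0"
      by (cases v') (auto simp: strip_def dgg_step_def entry_def split: if_splits)
    then obtain k' where k: "k = Suc k'"
      by (cases k) auto
    have in_S': "(2, m + 2) \<in> ?S" "(?q, m + 2) \<in> ?S"
      by (simp_all add: k strip_Suc)
    have "sublist [(?p, m), (?p, m + 1)] vs"
      unfolding vs_up sublist_def by (metis append_Cons append_Nil)
    \<comment> \<open>The one successor of \<open>(?p, m)\<close> is taken, so \<open>(2, m)\<close>
      must be entered from above.\<close>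
    then have not_row: "\<not> sublist [(?p, m), (2, m)] vs"
      using sublist_succ_unique[OF _ _ *(2)] by fastforce
    obtain u where "u \<in> ?S" "dgg_step u (2, m)" "sublist [u, (2, m)] vs"
      using ham_lists_pred[OF vs in_S(2)] hd by auto
    moreover from this have "u = (?p, m) \<or> u = (2, m + 1)"
      by (cases u) (auto simp: strip_def dgg_step_def entry_def split: if_splits)
    ultimately have a1: "sublist [(2, m + 1), (2, m)] vs"
      using not_row by auto
    have a2: "sublist [(2, m), (?q, m)] vs"
      by (rule ham_lists_row_arc[OF vs])
    have a3: "sublist [(?q, m), (?q, m + 1)] vs"
    proof (rule ham_lists_unique_pred[OF vs in_S(6)])
      show "hd vs \<noteq> (?q, m + 1)"
        using hd by simp
      show "u = (?q, m)" if "u \<in> ?S" "dgg_step u (?q, m + 1)" for u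
        using that
        by (cases u) (auto simp: strip_def dgg_step_def entry_def split: if_splits, presburger+)
    qed
    have c3: "sublist [(2, m + 1), (2, m), (?q, m), (?q, m + 1)] vs"
      using sublist_chain[OF _ a3 *(2), of "[(2, m + 1), (2, m)]"]
        sublist_chain[OF _ a2 *(2), of "[(2, m + 1)]"] a1 by simp
    \<comment> \<open>This arc would close the forced chain \<open>c3\<close> to a cycle, so
      \<open>(2, m + 1)\<close> too must be entered from above.\<close>
    have no_cycle: "\<not> sublist [(?q, m + 1), (2, m + 1)] vs"
    proof
      assume "sublist [(?q, m + 1), (2, m + 1)] vs"
      from sublist_chain[OF _ this *(2), of "[(2, m + 1), (2, m), (?q, m)]"] c3
      have "sublist [(2, m + 1), (2, m), (?q, m), (?q, m + 1), (2, m + 1)] vs"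
        by simp
      then show False
        using *(2) by (auto simp: sublist_def)
    qed
    obtain u where "u \<in> ?S" "dgg_step u (2, m + 1)" "sublist [u, (2, m + 1)] vs"
      using ham_lists_pred[OF vs in_S(5)] hd by auto
    moreover from this have "u = (?q, m + 1) \<or> u = (2, m + 2)"
      by (cases u) (auto simp: strip_def dgg_step_def entry_def split: if_splits)
    ultimately have a4: "sublist [(2, m + 2), (2, m + 1)] vs"
      using no_cycle by auto
    \<comment> \<open>As \<open>(2, m + 2)\<close> moves down, \<open>(?q, m + 2)\<close> can be
      entered only from \<open>(?q, m + 1)\<close>.\<close>
    then have not_row': "\<not> sublist [(2, m + 2), (?q, m + 2)] vs"
      using sublist_succ_unique[OF _ _ *(2)] by fastforce
    obtain u where "u \<in> ?S" "dgg_step u (?q, m + 2)" "sublist [u, (?q, m + 2)] vs"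
      using ham_lists_pred[OF vs in_S'(2)] hd by auto
    moreover from this have "u = (?q, m + 1) \<or> u = (2, m + 2)"
      by (cases u) (auto simp: strip_def dgg_step_def entry_def split: if_splits)
    ultimately have a5: "sublist [(?q, m + 1), (?q, m + 2)] vs"
      using not_row' by auto
    have "sublist [(2, m + 2), (2, m + 1), (2, m), (?q, m), (?q, m + 1), (?q, m + 2)] vs"
      using sublist_chain[OF _ a1 *(2), of "[(2, m + 2)]"]
        sublist_chain[OF _ a2 *(2), of "[(2, m + 2), (2, m + 1)]"]
        sublist_chain[OF _ a3 *(2), of "[(2, m + 2), (2, m + 1), (2, m)]"]
        sublist_chain[OF _ a5 *(2), of "[(2, m + 2), (2, m + 1), (2, m), (?q, m)]"] a4
      by simp
    then obtain xs ys where split: "vs = xs @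
        [(2, m + 2), (2, m + 1), (2, m), (?q, m), (?q, m + 1), (?q, m + 2)] @ ys"
      by (auto simp: sublist_def)
    obtain xs' where xs: "xs = [(?p, m), (?p, m + 1)] @ xs'"
      using split vs_up by (cases xs; cases "tl xs") auto
    \<comment> \<open>The two initial vertices are dropped and the forced segment is contracted to
      its end points, which row \<open>m + 2\<close> joins by an arc.\<close>
    define zs where "zs = xs' @ [(2, m + 2)] @ (?q, m + 2) # ys"
    have "distinct zs"
      using *(2) unfolding split xs zs_def by auto
    then have vs_eq: "vs = add_two_rows m zs"
      using add_two_rows_split[of xs' m "(?q, m + 2) # ys"] unfolding zs_def split xs by simp
    have "set zs = set vs - {(?p, m), (?p, m + 1), (2, m + 1), (2, m), (?q, m), (?q, m + 1)}"
      using *(2) unfolding split xs zs_def by auto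
    also have "\<dots> = strip (m + 2) k"
      unfolding *(3) strip_Suc[of m] strip_Suc[of "Suc m"] by auto
    finally have "set zs = strip (m + 2) k" .
    moreover have "successively dgg_step zs"
      using *(4) step_from_row(2)[of "m + 2"] unfolding split xs zs_def
      by (auto simp: successively_append_iff successively_Cons)
    ultimately have "zs \<in> ham_lists (strip (m + 2) k)"
      using \<open>distinct zs\<close> by (simp add: ham_lists_def zs_def)
    with vs_eq show ?thesis
      by blast
  qed
qed

section \<open>The Fibonacci count\<close>

lemma card_ham_lists_strip: "card (ham_lists (strip m k)) = fib k"
\<comment> \<open>The start \<open>m\<close> varies because removing rows moves it to
  \<open>Suc m\<close> or \<open>m + 2\<close>; the count does not depend on its parity.\<close>
proof (induction k arbitrary: m rule: fib.induct)
  case 1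
  \<comment> \<open>Since \<open>ham_lists\<close> excludes the empty list, the strip without rows
    has no path, in accordance with \<open>fib 0 = 0\<close>.\<close>
  show ?case
    by (auto simp: ham_lists_def)
next
  case 2
  have "ham_lists (strip m (Suc 0)) = {[(entry m, m), (2, m), (entry (Suc m), m)]}" (is "?H = {?w}")
  proof
    show "?H \<subseteq> {?w}"
    proof
      fix vs assume vs: "vs \<in> ?H"
      then have "length vs = card (strip m (Suc 0))"
        by (auto simp: ham_lists_def simp flip: distinct_card)
      also have "\<dots> = 3"
        by (simp add: strip_def)
      finally have "length vs = 3" .
      moreover obtain xs ys where "vs = (entry m, m) # xs @ [(2, m), (entry (Suc m), m)] @ ys"
        using ham_lists_strip_split[OF vs] by blast
      ultimately show "vs \<in> {?w}"
        by simp
    qed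
    show "{?w} \<subseteq> ?H"
      using step_from_row[of m] by (auto simp: ham_lists_def strip_Suc)
  qed
  then show ?case
    by simp
next
  case (3 k)
  have fin: "finite (ham_lists (strip m k))" for m k
    by (simp add: finite_ham_lists strip_def)
  let ?A = "add_row m ` ham_lists (strip (Suc m) (Suc k))"
  let ?B = "add_two_rows m ` ham_lists (strip (m + 2) k)"
  have "ham_lists (strip m (Suc (Suc k))) = ?A \<union> ?B"
    using ham_lists_cases[of _ m k] add_row_in_ham_lists[of _ m k]
      add_two_rows_in_ham_lists[of _ m k] by blast
  \<comment> \<open>The second entries differ: \<open>(2, m)\<close> against
    \<open>(entry m, m + 1)\<close>.\<close>
  moreover have "?A \<inter> ?B = {}"
    by (auto simp: add_row_def add_two_rows_def)
  ultimately have "card (ham_lists (strip m (Suc (Suc k)))) = card ?A + card ?B"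
    by (simp add: card_Un_disjoint fin)
  also have "card ?A = fib (Suc k)"
    using 3(1) by (simp add: card_image inj_on_subset[OF inj_add_row])
  also have "card ?B = fib k"
    using 3(2)[of "m + 2"] inj_on_add_two_rows[of m k] by (simp add: card_image)
  finally show ?case
    by simp
qed

theorem mainTheorem3:
  fixes n :: nat
  assumes "n \<ge> 1"
  shows "h 3 n = fib n \<and> h n 3 = fib n"
proof -
  have "{1..3} \<times> {1..n} = strip 1 n"
    by (auto simp: strip_def)
  then have "h 3 n = fib n"
    by (simp only: h_def hamiltonian_path_DGG card_ham_lists_strip)
  with h_commute show ?thesis
    by metis
qed

end
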